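(* Let $n\ge 1$ and let $(x_1,y_1),\dots,(x_n,y_n)$ be data points with $x_i,y_i>0$ for all $i$, and such that for all $i\neq j$, $(x_i,y_i)\neq(x_j,y_j)$ and $(x_i,y_i)\neq(y_j,x_j)$. Put $g_i(\theta)=x_iy_i\theta^2+(x_i+y_i-1)\theta+1$ and $g=\prod_{i=1}^n g_i$. Suppose that none of the $g_i$ has a double zero, and that $g$ has exactly $l$ distinct repeated complex zeros $\alpha_1,\dots,\alpha_l$, where $\alpha_k$ is a zero of $g$ of multiplicity $n_k\ge 2$ for $k=1,\dots,l$, and put $m=\sum_{k=1}^l n_k$ ($\le 2n$). Then the ML-degree of the association parameter $\theta$ in GBED($\theta$) for these data is $2n+l-m$.
   Context: GBED($\theta$) is Gumbel's Type-I bivariate exponential distribution with association parameter $\theta\in[0,1]$, with density $e^{-(x+y+\theta xy)}[(1+\theta x)(1+\theta y)-\theta]$ on the first quadrant. For data $(x_i,y_i)$, $i=1,\dots,n$, put $c_i=x_iy_i$, $d_i=x_i+y_i-1$, $$f_i(\theta)=c_i^2\theta^2+c_i(d_i-2)\theta+(c_i-d_i),\qquad g_i(\theta)=c_i\theta^2+d_i\theta+1,$$ $$f(\theta)=\sum_{i=1}^n f_i(\theta)\prod_{j\neq i}g_j(\theta),\qquad g(\theta)=\prod_{i=1}^n g_i(\theta).$$ The score equation is $\sum_{i=1}^n f_i(\theta)/g_i(\theta)=0$, i.e. $f(\theta)/g(\theta)=0$. The ML-degree of $\theta$ for the given data is the number of solutions of the score equation over $\mathbb{C}$ counted with multiplicity,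 that is, the number of complex zeros of $f$ that are not zeros of $g$, each counted with its multiplicity as a zero of $f$. *)

theory Defs
  imports Complex_Main "HOL-Computational_Algebra.Polynomial"
begin

(* The density of GBED(theta) at (x, y) is exp (-(x + y + theta x y)) * g theta, where
   g theta = (1 + theta x) (1 + theta y) - theta.  With c = x y and d = x + y - 1, g is the
   polynomial gbed_g1 x y below, gbed_f1 x y is c g - g', and their quotient is minus the
   theta-derivative of the log density.  The polynomials have real coefficients but are taken over
   the complex numbers, as the score equation is to be solved there. *)

definition gbed_c :: "real \<Rightarrow> real \<Rightarrow> complex" where
  "gbed_c x y = complex_of_real (x * y)"

definition gbed_d :: "real \<Rightarrow> real \<Rightarrow> complex" where
  "gbed_d x y = complex_of_real (x + y - 1)"

definition gbed_f1 :: "real \<Rightarrow> real \<Rightarrow> complex poly" where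
  "gbed_f1 x y =
    [:gbed_c x y - gbed_d x y, gbed_c x y * (gbed_d x y - 2), (gbed_c x y)\<^sup>2:]"

definition gbed_g1 :: "real \<Rightarrow> real \<Rightarrow> complex poly" where
  "gbed_g1 x y = [:1, gbed_d x y, gbed_c x y:]"

(* The data points are (x i, y i) for i in {1..n}. *)

definition gbed_f :: "nat \<Rightarrow> (nat \<Rightarrow> real) \<Rightarrow> (nat \<Rightarrow> real) \<Rightarrow> complex poly" where
  "gbed_f n x y =
    (\<Sum>i\<in>{1..n}. gbed_f1 (x i) (y i) * (\<Prod>j\<in>{1..n} - {i}. gbed_g1 (x j) (y j)))"

definition gbed_g :: "nat \<Rightarrow> (nat \<Rightarrow> real) \<Rightarrow> (nat \<Rightarrow> real) \<Rightarrow> complex poly" where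
  "gbed_g n x y = (\<Prod>i\<in>{1..n}. gbed_g1 (x i) (y i))"

(* The ML-degree: the number of complex solutions of f / g = 0, each counted with its
   multiplicity as a zero of f.  For n >= 1 and positive data f has degree 2 n, so the
   index set is finite; for f = 0 the value carries no meaning. *)

definition gbed_ml_degree :: "nat \<Rightarrow> (nat \<Rightarrow> real) \<Rightarrow> (nat \<Rightarrow> real) \<Rightarrow> nat" where
  "gbed_ml_degree n x y =
    (\<Sum>z | poly (gbed_f n x y) z = 0 \<and> poly (gbed_g n x y) z \<noteq> 0. order z (gbed_f n x y))"

end

theory Submission
  imports Defs "HOL-Computational_Algebra.Fundamental_Theorem_Algebra"
begin

text \<open>
  Since \<open>f\<^sub>i = c\<^sub>i g\<^sub>i - g\<^sub>i'\<close>, the product rule collapses the numerator of the score equation to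
  \<open>f = C g - g'\<close> with \<open>C = c\<^sub>1 + \<dots> + c\<^sub>n\<close> (lemma \<open>gbed_f_eq\<close>). Positivity of the data makes \<open>C\<close>
  nonzero and every \<open>g\<^sub>i\<close> quadratic, so \<open>f\<close> and \<open>g\<close> both have degree \<open>2n\<close>, and \<open>f\<close> has \<open>2n\<close>
  complex zeros counted with multiplicity.

  What remains is to discard the zeros that \<open>f\<close> shares with \<open>g\<close>. At a zero of \<open>g\<close> of
  multiplicity \<open>k\<close>, the derivative \<open>g'\<close> vanishes to order exactly \<open>k - 1\<close>, and the term \<open>C g\<close>,
  which vanishes to the higher order \<open>k\<close>, does not change this; hence \<open>f\<close> vanishes there to order
  \<open>k - 1\<close> (lemma \<open>order_smult_diff_pderiv\<close>). Simple zeros of \<open>g\<close> thus cost nothing, while a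
  repeated zero of multiplicity \<open>n\<^sub>k\<close> costs \<open>n\<^sub>k - 1\<close>, in total \<open>m - l\<close>.
\<close>

text \<open>Differentiation lowers the degree, so the leading coefficient \<open>C * lead_coeff p\<close> survives.\<close>

lemma degree_smult_diff_pderiv:
  fixes p :: "'a::{idom,semiring_char_0} poly"
  assumes "C \<noteq> 0"
  shows "degree (smult C p - pderiv p) = degree p"
proof (rule antisym)
  show "degree (smult C p - pderiv p) \<le> degree p"
    by (intro degree_diff_le degree_smult_le) (simp add: degree_pderiv)
  show "degree p \<le> degree (smult C p - pderiv p)"
  proof (cases "p = 0")
    case False
    have "coeff (smult C p - pderiv p) (degree p) = C * lead_coeff p"
      by (simp add: coeff_pderiv coeff_eq_0)
    then show ?thesis
      using assms False by (intro le_degree) simp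
  qed simp
qed

lemma smult_diff_pderiv_nonzero:
  fixes p :: "'a::{idom,semiring_char_0} poly"
  assumes "C \<noteq> 0" and "p \<noteq> 0"
  shows "smult C p - pderiv p \<noteq> 0"
proof
  assume eq: "smult C p - pderiv p = 0"
  then have "degree p = 0"
    using degree_smult_diff_pderiv[OF assms(1), of p] by simp
  then have "pderiv p = 0"
    by (simp add: pderiv_eq_0_iff)
  then show False
    using eq assms by simp
qed

text \<open>
  The factor \<open>X - a\<close> divides the two terms to the orders \<open>k\<close> and \<open>k - 1\<close>; these differ, so the
  smaller one is the order of the difference.
\<close>

lemma order_smult_diff_pderiv:
  fixes p :: "'a::{idom,semiring_char_0} poly"
  assumes "p \<noteq> 0" and "poly p a = 0"
  shows "order a (smult C p - pderiv p) = order a p - 1"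
proof -
  let ?k = "order a p - 1"
  have ord: "order a p = Suc ?k"
    using order_pderiv[OF assms] by simp
  have nz: "pderiv p \<noteq> 0"
  proof
    assume "pderiv p = 0"
    then obtain b where "p = [:b:]"
      by (auto simp: pderiv_eq_0_iff elim: degree_eq_zeroE)
    then show False
      using assms by simp
  qed
  have ord': "order a (pderiv p) = ?k"
    using order_pderiv[OF assms] by simp
  have low: "[:- a, 1:] ^ ?k dvd p" "[:- a, 1:] ^ ?k dvd pderiv p"
    by (simp_all add: order_divides ord')
  have high: "[:- a, 1:] ^ Suc ?k dvd p" "\<not> [:- a, 1:] ^ Suc ?k dvd pderiv p"
    using ord ord' nz unfolding order_divides by linarith+
  have "[:- a, 1:] ^ ?k dvd smult C p - pderiv p"
    using low by (intro dvd_diff dvd_smult)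
  moreover have "\<not> [:- a, 1:] ^ Suc ?k dvd smult C p - pderiv p"
  proof
    assume "[:- a, 1:] ^ Suc ?k dvd smult C p - pderiv p"
    then have "[:- a, 1:] ^ Suc ?k dvd smult C p - (smult C p - pderiv p)"
      by (rule dvd_diff[OF dvd_smult[OF high(1)]])
    then show False
      using high(2) by simp
  qed
  ultimately show ?thesis
    by (rule order_unique_lemma)
qed

lemma sum_order_complex:
  fixes p :: "complex poly"
  assumes "p \<noteq> 0"
  shows "(\<Sum>z | poly p z = 0. order z p) = degree p"
  using size_proots_complex[of p] assms by (simp add: size_multiset_overloaded_eq)

text \<open>
  By the fundamental theorem of algebra \<open>C p - p'\<close> has exactly \<open>degree p\<close> zeros. The ones it shares
  with \<open>p\<close> are precisely the repeated zeros of \<open>p\<close>, because at a simple zero of \<open>p\<close> the order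
  drops to \<open>0\<close>.
\<close>

lemma sum_order_smult_diff_pderiv:
  fixes p :: "complex poly"
  assumes "C \<noteq> 0" and "p \<noteq> 0"
  defines "q \<equiv> smult C p - pderiv p"
  shows "(\<Sum>z | poly q z = 0 \<and> poly p z \<noteq> 0. order z q) + (\<Sum>z | order z p \<ge> 2. order z p - 1)
    = degree p"
proof -
  have q: "q \<noteq> 0"
    unfolding q_def using assms(1,2) by (rule smult_diff_pderiv_nonzero)
  have fin: "finite {z. poly q z = 0}"
    using q by (rule poly_roots_finite)
  have order_q: "order z q = order z p - 1" if "poly p z = 0" for z
    unfolding q_def using assms(2) that by (rule order_smult_diff_pderiv)
  have repeated: "{z. poly q z = 0 \<and> poly p z = 0} = {z. order z p \<ge> 2}"
  proof (intro Collect_cong)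
    fix z
    show "poly q z = 0 \<and> poly p z = 0 \<longleftrightarrow> order z p \<ge> 2"
      using order_q[of z] order_root[of q z] order_root[of p z] q assms(2) by auto
  qed
  have "degree p = (\<Sum>z | poly q z = 0. order z q)"
    using sum_order_complex[OF q] degree_smult_diff_pderiv[OF assms(1), of p] by (simp add: q_def)
  also have "{z. poly q z = 0} =
      {z. poly q z = 0 \<and> poly p z \<noteq> 0} \<union> {z. poly q z = 0 \<and> poly p z = 0}"
    by blast
  also have "(\<Sum>z\<in>\<dots>. order z q) = (\<Sum>z | poly q z = 0 \<and> poly p z \<noteq> 0. order z q)
      + (\<Sum>z | poly q z = 0 \<and> poly p z = 0. order z q)"
    using fin by (intro sum.union_disjoint) (auto intro: finite_subset)
  also have "(\<Sum>z | poly q z = 0 \<and> poly p z = 0. order z q) = (\<Sum>z | order z p \<ge> 2. order z p - 1)"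
    unfolding repeated[symmetric] by (intro sum.cong) (auto simp: order_q)
  finally show ?thesis
    by simp
qed

lemma gbed_f1_eq: "gbed_f1 x y = smult (gbed_c x y) (gbed_g1 x y) - pderiv (gbed_g1 x y)"
  by (simp add: gbed_f1_def gbed_g1_def pderiv_pCons power2_eq_square algebra_simps)

lemma gbed_f_eq:
  "gbed_f n x y = smult (\<Sum>i\<in>{1..n}. gbed_c (x i) (y i)) (gbed_g n x y) - pderiv (gbed_g n x y)"
proof -
  let ?g = "\<lambda>i. gbed_g1 (x i) (y i)"
  have "gbed_f1 (x i) (y i) * prod ?g ({1..n} - {i}) =
      smult (gbed_c (x i) (y i)) (prod ?g {1..n}) - prod ?g ({1..n} - {i}) * pderiv (?g i)"
    if "i \<in> {1..n}" for i
  proof -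
    have "prod ?g {1..n} = ?g i * prod ?g ({1..n} - {i})"
      using that by (intro prod.remove) simp_all
    then show ?thesis
      by (simp add: gbed_f1_eq algebra_simps)
  qed
  then have "gbed_f n x y = (\<Sum>i\<in>{1..n}. smult (gbed_c (x i) (y i)) (prod ?g {1..n})
      - prod ?g ({1..n} - {i}) * pderiv (?g i))"
    unfolding gbed_f_def by (intro sum.cong) auto
  then show ?thesis
    unfolding gbed_g_def by (simp add: pderiv_prod sum_subtractf smult_sum)
qed

lemma degree_gbed_g:
  assumes "\<And>i. i \<in> {1..n} \<Longrightarrow> x i > 0 \<and> y i > 0"
  shows "degree (gbed_g n x y) = 2 * n"
proof -
  have "degree (gbed_g1 (x i) (y i)) = 2" if "i \<in> {1..n}" for i
    using assms[OF that] by (auto simp: gbed_g1_def gbed_c_def)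
  moreover have "gbed_g1 a b \<noteq> 0" for a b
    by (simp add: gbed_g1_def)
  ultimately show ?thesis
    unfolding gbed_g_def by (subst degree_prod_sum_eq) simp_all
qed

lemma sum_gbed_c_nonzero:
  fixes n :: nat
  assumes "n \<ge> 1" and "\<And>i. i \<in> {1..n} \<Longrightarrow> x i > 0 \<and> y i > 0"
  shows "(\<Sum>i\<in>{1..n}. gbed_c (x i) (y i)) \<noteq> 0"
proof -
  have "(\<Sum>i\<in>{1..n}. x i * y i) > 0"
    using assms by (intro sum_pos) auto
  moreover have "(\<Sum>i\<in>{1..n}. gbed_c (x i) (y i)) = complex_of_real (\<Sum>i\<in>{1..n}. x i * y i)"
    by (simp add: gbed_c_def)
  ultimately show ?thesis
    by (simp only: of_real_eq_0_iff)
qed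

theorem theorem5p4:
  fixes n l m :: nat
    and x y :: "nat \<Rightarrow> real"
    and \<alpha> :: "nat \<Rightarrow> complex"
    and N :: "nat \<Rightarrow> nat"
  assumes "n \<ge> 1"
    and "\<And>i. i \<in> {1..n} \<Longrightarrow> x i > 0 \<and> y i > 0"
    and "\<And>i j. i \<in> {1..n} \<Longrightarrow> j \<in> {1..n} \<Longrightarrow> i \<noteq> j \<Longrightarrow>
           (x i, y i) \<noteq> (x j, y j) \<and> (x i, y i) \<noteq> (y j, x j)"
    and "\<And>i z. i \<in> {1..n} \<Longrightarrow> order z (gbed_g1 (x i) (y i)) \<noteq> 2"
    and "inj_on \<alpha> {1..l}"
    and "\<alpha> ` {1..l} = {z. order z (gbed_g n x y) \<ge> 2}"
    and "\<And>k. k \<in> {1..l} \<Longrightarrow> order (\<alpha> k) (gbed_g n x y) = N k"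
    and "m = (\<Sum>k\<in>{1..l}. N k)"
  shows "int (gbed_ml_degree n x y) = 2 * int n + int l - int m"
proof -
  let ?g = "gbed_g n x y"
  have g: "?g \<noteq> 0"
    by (simp add: gbed_g_def gbed_g1_def)
  have N: "N k \<ge> 2" if "k \<in> {1..l}" for k
  proof -
    have "\<alpha> k \<in> {z. order z ?g \<ge> 2}"
      unfolding assms(6)[symmetric] using that by (rule imageI)
    then show ?thesis
      using assms(7)[OF that] by simp
  qed
  have "(\<Sum>z | order z ?g \<ge> 2. order z ?g - 1) = (\<Sum>k\<in>{1..l}. order (\<alpha> k) ?g - 1)"
    unfolding assms(6)[symmetric] by (subst sum.reindex[OF assms(5)]) (simp add: comp_def)
  also have "\<dots> = (\<Sum>k\<in>{1..l}. N k - 1)"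
    using assms(7) by (intro sum.cong) simp_all
  finally have "int (\<Sum>z | order z ?g \<ge> 2. order z ?g - 1) = (\<Sum>k\<in>{1..l}. int (N k - 1))"
    by simp
  also have "\<dots> = (\<Sum>k\<in>{1..l}. int (N k) - 1)"
    using N by (intro sum.cong) (fastforce simp: of_nat_diff)+
  also have "\<dots> = int m - int l"
    by (simp add: assms(8) sum_subtractf)
  finally have lost: "int (\<Sum>z | order z ?g \<ge> 2. order z ?g - 1) = int m - int l" .
  have "gbed_ml_degree n x y + (\<Sum>z | order z ?g \<ge> 2. order z ?g - 1) = degree ?g"
    unfolding gbed_ml_degree_def gbed_f_eq
    using sum_gbed_c_nonzero[OF assms(1,2)] g by (rule sum_order_smult_diff_pderiv)
  also have "\<dots> = 2 * n"
    using assms(2) by (rule degree_gbed_g)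
  finally show ?thesis
    using lost by linarith
qed

end
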